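(* Let $F:\mathbb{R}^d\to\mathbb{R}$ be such that $\nabla F$ has a continuous second order derivative and the first and second derivatives of $\nabla F$ are bounded. Let $x:[0,\infty)\to\mathbb{R}^d$ be a solution of $\ddot{x}(t)+\frac{3}{t}\dot{x}(t)+\nabla F(x(t))=0$ ($t>0$) which has a continuous fourth derivative. Then for every fixed $t>0$, the truncation error of SAG, $$L[x(t);h]=\left(2+\frac{4h}{t}\right)x(t+h)-\left(5+\frac{9h}{2t}+\frac{3h^2}{t^2}\right)x(t)+\left(4+\frac{3h^2}{t^2}\right)x(t-h)-\left(1-\frac{h}{2t}\right)x(t-2h)+h^2\nabla F\left(x(t)+\frac{t-3h}{t}\bigl(x(t)-x(t-h)\bigr)\right),$$ satisfies $L[x(t);h]=\mathcal{O}(h^4)$ as $h\to0^+$.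
   Context: The stabilized accelerated gradient method (SAG) with step size $s=h^2$ is the recurrence $$x_{n+1}=\frac{10n^2+9n+6}{4n^2+8n}x_n-\frac{4n^2+3}{2n^2+4n}x_{n-1}+\frac{2n-1}{4n+8}x_{n-2}-\frac{n}{2n+4}h^2\nabla F\left(\frac{2n-3}{n}x_n-\frac{n-3}{n}x_{n-1}\right).$$ Equivalently, $\sum_{i=1}^4\left(\alpha_i+\frac{\beta_i}{n}+\frac{\gamma_i}{n^2}\right)x_{n+2-i}=-h^2\nabla F\left(x_n+\frac{n-3}{n}(x_n-x_{n-1})\right)$ with $(\alpha_i)=(2,-5,4,-1)$, $(\beta_i)=(4,-\frac92,0,\frac12)$, $(\gamma_i)=(0,-3,3,0)$. The truncation error of such a recurrence is defined as $$L[x(t);h]=\sum_{i=1}^4\left(\alpha_i+\frac{\beta_ih}{t}+\frac{\gamma_ih^2}{t^2}\right)x(t+(2-i)h)+h^2\nabla F\left(x(t)+\frac{t-3h}{t}(x(t)-x(t-h))\right),$$ which for these coefficients is the expression in the claim. The constant in $\mathcal{O}(h^4)$ may depend on $t$, $F$ and $x$; $h$ is taken small enough that $t-2h>0$. *)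

theory Defs
  imports "HOL-Analysis.Analysis" "HOL-Library.Landau_Symbols"
begin

text \<open>The gradient; only meaningful at points where \<open>F\<close> is differentiable.\<close>

definition grad :: "('a::real_inner \<Rightarrow> real) \<Rightarrow> 'a \<Rightarrow> 'a" where
  "grad F y = (THE D. GDERIV F y :> D)"

lemma grad_eqI:
  assumes "GDERIV F y :> D"
  shows "grad F y = D"
proof -
  have "D' = D" if "GDERIV F y :> D'" for D'
  proof -
    have "(\<lambda>v. v \<bullet> D') = (\<lambda>v. v \<bullet> D)"
      using has_derivative_unique[of F] that assms unfolding gderiv_def by blast
    then show ?thesis by (metis inner_commute vector_eq_rdot)
  qed
  with assms show ?thesis unfolding grad_def by blast
qed

lemma GDERIV_grad:
  fixes F :: "'a::euclidean_space \<Rightarrow> real"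
  assumes "F differentiable (at y)"
  shows "GDERIV F y :> grad F y"
proof -
  obtain F' where F': "(F has_derivative F') (at y)"
    using assms unfolding differentiable_def by blast
  then have lin: "linear F'" by (rule has_derivative_linear)
  have "F' = (\<lambda>v. v \<bullet> adjoint F' 1)"
    using adjoint_works[OF lin, of _ "1::real"] by (simp add: fun_eq_iff)
  with F' have "GDERIV F y :> adjoint F' 1"
    unfolding gderiv_def by metis
  then show ?thesis using grad_eqI by metis
qed

text \<open>Truncation error of a recurrence
  \<open>(\<Sum>i = 1..4. (\<alpha>\<^sub>i + \<beta>\<^sub>i / n + \<gamma>\<^sub>i / n\<^sup>2) x\<^sub>n\<^sub>+\<^sub>2\<^sub>-\<^sub>i) = - h\<^sup>2 G (x\<^sub>n + (n - 3) / n (x\<^sub>n - x\<^sub>n\<^sub>-\<^sub>1))\<close>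
  along a curve \<open>x\<close>, obtained by substituting \<open>n = t / h\<close>; \<open>G\<close> plays the role of the gradient.\<close>

definition truncation_error ::
  "(nat \<Rightarrow> real) \<Rightarrow> (nat \<Rightarrow> real) \<Rightarrow> (nat \<Rightarrow> real) \<Rightarrow> ('a::real_vector \<Rightarrow> 'a) \<Rightarrow> (real \<Rightarrow> 'a) \<Rightarrow> real \<Rightarrow> real \<Rightarrow> 'a"
where
  "truncation_error \<alpha> \<beta> \<gamma> G x t h =
     (\<Sum>i = 1..4. (\<alpha> i + \<beta> i * h / t + \<gamma> i * h\<^sup>2 / t\<^sup>2) *\<^sub>R x (t + (2 - real i) * h))
     + h\<^sup>2 *\<^sub>R G (x t + ((t - 3 * h) / t) *\<^sub>R (x t - x (t - h)))"

text \<open>Coefficients are used for the indices 1, ..., 4 only.\<close>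

definition sag_\<alpha> :: "nat \<Rightarrow> real" where
  "sag_\<alpha> i = [2, -5, 4, -1] ! (i - 1)"

definition sag_\<beta> :: "nat \<Rightarrow> real" where
  "sag_\<beta> i = [4, -9/2, 0, 1/2] ! (i - 1)"

definition sag_\<gamma> :: "nat \<Rightarrow> real" where
  "sag_\<gamma> i = [0, -3, 3, 0] ! (i - 1)"

definition sag_truncation_error ::
  "('a::real_vector \<Rightarrow> 'a) \<Rightarrow> (real \<Rightarrow> 'a) \<Rightarrow> real \<Rightarrow> real \<Rightarrow> 'a"
where
  "sag_truncation_error = truncation_error sag_\<alpha> sag_\<beta> sag_\<gamma>"

lemma sum_1_4: "(\<Sum>i = 1..4::nat. f i) = f 1 + f 2 + f 3 + (f 4 :: 'b::comm_monoid_add)"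
  by (simp add: eval_nat_numeral ac_simps)

text \<open>These coefficients are those of the SAG recurrence.\<close>

lemma sag_recurrence_iff:
  fixes X :: "nat \<Rightarrow> 'a::real_vector" and n :: nat
  assumes "n \<ge> 2"
  defines "r \<equiv> real n"
  shows "X (n + 1) =
           ((10 * r\<^sup>2 + 9 * r + 6) / (4 * r\<^sup>2 + 8 * r)) *\<^sub>R X n
           - ((4 * r\<^sup>2 + 3) / (2 * r\<^sup>2 + 4 * r)) *\<^sub>R X (n - 1)
           + ((2 * r - 1) / (4 * r + 8)) *\<^sub>R X (n - 2)
           - (r / (2 * r + 4) * h\<^sup>2) *\<^sub>R
               G (((2 * r - 3) / r) *\<^sub>R X n - ((r - 3) / r) *\<^sub>R X (n - 1))
         \<longleftrightarrow>
         (\<Sum>i = 1..4. (sag_\<alpha> i + sag_\<beta> i / r + sag_\<gamma> i / r\<^sup>2) *\<^sub>R X (n + 2 - i))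
           = - (h\<^sup>2 *\<^sub>R G (X n + ((r - 3) / r) *\<^sub>R (X n - X (n - 1))))"
    (is "X (n + 1) = ?a *\<^sub>R _ - ?b *\<^sub>R _ + ?c *\<^sub>R _ - (?d * _) *\<^sub>R G ?y
         \<longleftrightarrow> ?S = - (_ *\<^sub>R G ?z)")
proof -
  have r: "r > 0" using assms by simp
  define k where "k = (2 * r + 4) / r"
  have k: "k \<noteq> 0" "k * ?d = 1" using r by (simp_all add: k_def)
  have "(2 * r - 3) / r = 1 + (r - 3) / r"
    using r by (simp add: field_simps)
  then have yz: "?y = ?z"
    by (simp only: scaleR_left_distrib scaleR_right_diff_distrib) simp
  have f: "4 * r\<^sup>2 + 8 * r = 4 * r * (r + 2)" "2 * r\<^sup>2 + 4 * r = 2 * r * (r + 2)"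
    "4 * r + 8 = 4 * (r + 2)" "2 * r + 4 = 2 * (r + 2)"
    by (simp_all add: algebra_simps power2_eq_square)
  have a: "sag_\<alpha> 2 + sag_\<beta> 2 / r + sag_\<gamma> 2 / r\<^sup>2 = - (k * ?a)"
   and b: "sag_\<alpha> 3 + sag_\<beta> 3 / r + sag_\<gamma> 3 / r\<^sup>2 = k * ?b"
   and c: "sag_\<alpha> 4 + sag_\<beta> 4 / r + sag_\<gamma> 4 / r\<^sup>2 = - (k * ?c)"
   and d: "sag_\<alpha> 1 + sag_\<beta> 1 / r + sag_\<gamma> 1 / r\<^sup>2 = k"
    unfolding k_def f using r
    by (simp_all add: sag_\<alpha>_def sag_\<beta>_def sag_\<gamma>_def divide_simps; simp add: algebra_simps power2_eq_square)+
  have idx: "n + 2 - 1 = n + 1" "n + 2 - 2 = n" "n + 2 - 3 = n - 1" "n + 2 - 4 = n - 2"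
    using assms by auto
  let ?R = "?a *\<^sub>R X n - ?b *\<^sub>R X (n - 1) + ?c *\<^sub>R X (n - 2) - (?d * h\<^sup>2) *\<^sub>R G ?y"
  have "X (n + 1) = ?R \<longleftrightarrow> k *\<^sub>R X (n + 1) = k *\<^sub>R ?R"
    using k by simp
  also have "k *\<^sub>R ?R = (k * ?a) *\<^sub>R X n - (k * ?b) *\<^sub>R X (n - 1) + (k * ?c) *\<^sub>R X (n - 2)
      - ((k * ?d) * h\<^sup>2) *\<^sub>R G ?y"
    by (simp only: scaleR_right_diff_distrib scaleR_right_distrib scaleR_scaleR mult.assoc)
  also have "\<dots> = (k * ?a) *\<^sub>R X n - (k * ?b) *\<^sub>R X (n - 1) + (k * ?c) *\<^sub>R X (n - 2)
      - h\<^sup>2 *\<^sub>R G ?z"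
    by (simp only: k yz mult_1_left)
  also have "k *\<^sub>R X (n + 1) = \<dots> \<longleftrightarrow> ?S = - (h\<^sup>2 *\<^sub>R G ?z)"
    unfolding sum_1_4 a b c d idx
    by (simp only: scaleR_minus_left) (auto simp: algebra_simps eq_neg_iff_add_eq_0)
  finally show ?thesis .
qed

end

theory Submission
  imports Defs
begin

text \<open>Expanding \<open>x (t + h)\<close>, \<open>x (t - h)\<close> and \<open>x (t - 2 * h)\<close> to third order, the coefficients
  of \<open>1\<close> and \<open>h\<close> cancel, and the linear part becomes
  \<open>h\<^sup>2 (x2 + (3/t) x1) + h\<^sup>3 (x3 + (3/t) x2 - (3/t\<^sup>2) x1)\<close>. The gradient term contributes
  \<open>h\<^sup>2 \<nabla>F(x) + h\<^sup>3 D(\<nabla>F)(x) x1\<close>, so the terms of order two cancel by the differential equation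
  and those of order three by its derivative.\<close>

section \<open>Taylor remainder bounds for curves and for maps between normed spaces\<close>

text \<open>Induction on \<open>n\<close>: the remainder of order \<open>Suc n\<close> vanishes at
  \<open>a\<close>, and its derivative is the remainder of order \<open>n\<close> of the shifted
  family \<open>f (Suc k)\<close>. The mean value inequality on the segment from \<open>a\<close> to
  \<open>s\<close> then yields one more factor \<open>\<bar>s - a\<bar>\<close>. This route loses
  the factor \<open>1 / fact n\<close>, which does not matter for order estimates.\<close>

lemma vector_taylor_bound:
  fixes f :: "nat \<Rightarrow> real \<Rightarrow> 'a::real_normed_vector"
  assumes S: "convex S" "a \<in> S" "s \<in> S"
    and deriv: "\<And>k u. k < n \<Longrightarrow> u \<in> S \<Longrightarrow> (f k has_vector_derivative f (Suc k) u) (at u within S)"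
    and bound: "\<And>u. u \<in> S \<Longrightarrow> norm (f n u) \<le> M"
  shows "norm (f 0 s - (\<Sum>k<n. ((s - a) ^ k / fact k) *\<^sub>R f k a)) \<le> M * \<bar>s - a\<bar> ^ n"
  using deriv bound S(3)
proof (induction n arbitrary: f s)
  case 0
  then show ?case by simp
next
  case (Suc n)
  define R where "R u = f 0 u - (\<Sum>k<Suc n. ((u - a) ^ k / fact k) *\<^sub>R f k a)" for u
  define R' where "R' u = f 1 u - (\<Sum>k<n. ((u - a) ^ k / fact k) *\<^sub>R f (Suc k) a)" for u
  have sub: "closed_segment a s \<subseteq> S"
    using S(1,2) Suc.prems(3) by (rule closed_segment_subset[rotated 2])
  have M: "M \<ge> 0"
    using Suc.prems(2)[OF S(2)] norm_ge_zero by (rule order_trans[rotated])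
  \<comment> \<open>Splitting off the summand \<open>k = 0\<close> leaves only powers
    \<open>Suc k\<close>, which vanish at \<open>a\<close> and differentiate termwise to the
    summands of \<open>R'\<close>.\<close>
  have R: "R u = f 0 u - f 0 a - (\<Sum>k<n. ((u - a) ^ Suc k / fact (Suc k)) *\<^sub>R f (Suc k) a)" for u
    unfolding R_def by (subst sum.lessThan_Suc_shift) simp
  have R': "norm (R' u) \<le> M * \<bar>u - a\<bar> ^ n" if "u \<in> S" for u
    using Suc.IH[of "\<lambda>k. f (Suc k)" u] Suc.prems(1,2) that unfolding R'_def by simp
  have *: "((\<lambda>u. ((u - a) ^ Suc k / fact (Suc k)) *\<^sub>R c) has_vector_derivative
      ((u - a) ^ k / fact k) *\<^sub>R c) (at u within S)" for k u and c :: 'a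
  proof -
    have "((\<lambda>u. (u - a) ^ Suc k / fact (Suc k)) has_real_derivative
        (real (Suc k) * (u - a) ^ k / fact (Suc k))) (at u within S)"
      by (auto intro!: derivative_eq_intros simp del: power_Suc fact_Suc)
    moreover have "real (Suc k) * (u - a) ^ k / fact (Suc k) = (u - a) ^ k / fact k"
      by (simp add: divide_simps)
    ultimately show ?thesis
      using has_vector_derivative_scaleR[OF _ has_vector_derivative_const[of c]] by fastforce
  qed
  have "(R has_vector_derivative R' u) (at u within S)" if "u \<in> S" for u
  proof -
    have "(R has_vector_derivative (f 1 u - 0 - (\<Sum>k<n. ((u - a) ^ k / fact k) *\<^sub>R f (Suc k) a)))
        (at u within S)"
      unfolding R using Suc.prems(1)[of 0 u] that
      by (intro has_vector_derivative_diff has_vector_derivative_sum * has_vector_derivative_const) auto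
    then show ?thesis by (simp add: R'_def)
  qed
  then have "(R has_derivative (\<lambda>h. h *\<^sub>R R' u)) (at u within closed_segment a s)"
    if "u \<in> closed_segment a s" for u
    using that sub by (auto simp: has_vector_derivative_def intro: has_derivative_subset)
  moreover have "onorm (\<lambda>h. h *\<^sub>R R' u) \<le> M * \<bar>s - a\<bar> ^ n" if "u \<in> closed_segment a s" for u
  proof -
    have "\<bar>u - a\<bar> \<le> \<bar>s - a\<bar>"
      using segment_bound1[OF that] by simp
    then have "norm (R' u) \<le> M * \<bar>s - a\<bar> ^ n"
      using R'[of u] that sub M
      by (meson mult_left_mono order_trans power_mono abs_ge_zero subsetD)
    then show ?thesis
      by (intro onorm_le) (simp add: mult.commute mult_left_mono)
  qed
  ultimately have "norm (R s - R a) \<le> M * \<bar>s - a\<bar> ^ n * norm (s - a)"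
    by (intro differentiable_bound[where S = "closed_segment a s"]) auto
  moreover have "R a = 0"
    unfolding R by simp
  ultimately show ?case
    by (simp add: R_def mult_ac)
qed

text \<open>The mean value inequality is used twice. The bound on \<open>D2\<close> makes
  \<open>D1\<close> Lipschitz with constant \<open>K\<close>, so \<open>D1\<close> deviates from
  \<open>D1 y\<close> by at most \<open>K * norm v\<close> on the ball of radius
  \<open>norm v\<close> around \<open>y\<close>. The linearization error over that ball gains a
  further factor \<open>norm v\<close>.\<close>

lemma taylor_bound_blinfun:
  fixes f :: "'a::real_normed_vector \<Rightarrow> 'b::real_normed_vector"
  assumes D1: "\<And>y. (f has_derivative blinfun_apply (D1 y)) (at y)"
    and D2: "\<And>y. (D1 has_derivative blinfun_apply (D2 y)) (at y)"
    and bound: "\<And>y. norm (D2 y) \<le> K"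
  shows "norm (f (y + v) - f y - D1 y v) \<le> K * (norm v)\<^sup>2"
proof -
  have K: "K \<ge> 0"
    using bound[of y] norm_ge_zero order_trans by blast
  have lip: "norm (D1 z - D1 y) \<le> K * norm v" if "z \<in> cball y (norm v)" for z
  proof -
    have "norm (D1 z - D1 y) \<le> K * norm (z - y)"
      using bound D2
      by (intro differentiable_bound[where S = UNIV and f' = "\<lambda>y. blinfun_apply (D2 y)"])
        (auto simp: norm_blinfun.rep_eq[symmetric])
    also have "\<dots> \<le> K * norm v"
      using that K by (intro mult_left_mono) (auto simp: dist_norm norm_minus_commute)
    finally show ?thesis .
  qed
  have "norm (f (y + v) - f y - D1 y (y + v - y)) \<le> norm (y + v - y) * (K * norm v)"
  proof (rule differentiable_bound_linearization[where S = "cball y (norm v)"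
        and f' = "\<lambda>y. blinfun_apply (D1 y)"])
    fix z assume "z \<in> cball y (norm v)"
    moreover have "blinfun_apply (D1 z) - blinfun_apply (D1 y) = blinfun_apply (D1 z - D1 y)"
      by (simp add: fun_eq_iff minus_blinfun.rep_eq)
    ultimately show "onorm (blinfun_apply (D1 z) - blinfun_apply (D1 y)) \<le> K * norm v"
      using lip by (simp add: norm_blinfun.rep_eq)
  qed (use D1 in \<open>auto simp: dist_norm mult_left_le_one_le intro: has_derivative_at_withinI\<close>)
  then show ?thesis by (simp add: power2_eq_square mult_ac)
qed

lemma continuous_on_Icc_norm_bound:
  fixes f :: "real \<Rightarrow> 'a::real_normed_vector"
  assumes "continuous_on {a..b} f"
  obtains M where "\<And>s. s \<in> {a..b} \<Longrightarrow> norm (f s) \<le> M"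
  using compact_imp_bounded[OF compact_continuous_image[OF assms compact_Icc]]
  unfolding bounded_iff by blast

section \<open>The truncation error written out, and its exact expansion\<close>

lemma sag_truncation_error_eq:
  "sag_truncation_error G x t h =
     (2 + 4 * h / t) *\<^sub>R x (t + h)
     - (5 + 9 * h / (2 * t) + 3 * h\<^sup>2 / t\<^sup>2) *\<^sub>R x t
     + (4 + 3 * h\<^sup>2 / t\<^sup>2) *\<^sub>R x (t - h)
     - (1 - h / (2 * t)) *\<^sub>R x (t - 2 * h)
     + h\<^sup>2 *\<^sub>R G (x t + ((t - 3 * h) / t) *\<^sub>R (x t - x (t - h)))"
proof -
  have "sag_\<alpha> 1 + sag_\<beta> 1 * h / t + sag_\<gamma> 1 * h\<^sup>2 / t\<^sup>2 = 2 + 4 * h / t"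
    "sag_\<alpha> 2 + sag_\<beta> 2 * h / t + sag_\<gamma> 2 * h\<^sup>2 / t\<^sup>2 = - (5 + 9 * h / (2 * t) + 3 * h\<^sup>2 / t\<^sup>2)"
    "sag_\<alpha> 3 + sag_\<beta> 3 * h / t + sag_\<gamma> 3 * h\<^sup>2 / t\<^sup>2 = 4 + 3 * h\<^sup>2 / t\<^sup>2"
    "sag_\<alpha> 4 + sag_\<beta> 4 * h / t + sag_\<gamma> 4 * h\<^sup>2 / t\<^sup>2 = - (1 - h / (2 * t))"
    by (simp_all add: sag_\<alpha>_def sag_\<beta>_def sag_\<gamma>_def)
  moreover have "t + (2 - real 1) * h = t + h" "t + (2 - real 2) * h = t"
    "t + (2 - real 3) * h = t - h" "t + (2 - real 4) * h = t - 2 * h"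
    by simp_all
  ultimately show ?thesis
    unfolding sag_truncation_error_def truncation_error_def sum_1_4
    by (simp only: scaleR_minus_left add_uminus_conv_diff)
qed

text \<open>The left side of the equation vanishes on the open half-line, hence so does its
  derivative at \<open>t\<close>. The chain rule gives \<open>G' (x1 t)\<close>, and the product
  rule with the derivative of \<open>3 / s\<close> gives the two middle terms.\<close>

lemma ode_derivative:
  fixes G :: "'a::real_normed_vector \<Rightarrow> 'a"
  assumes G: "(G has_derivative G') (at (x t))"
    and x: "(x has_vector_derivative x1 t) (at t)"
    and x1: "(x1 has_vector_derivative x2 t) (at t)"
    and x2: "(x2 has_vector_derivative x3 t) (at t)"
    and ode: "\<And>s. s > 0 \<Longrightarrow> x2 s + (3 / s) *\<^sub>R x1 s + G (x s) = 0"
    and t: "t > (0::real)"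
  shows "x3 t + (3 / t) *\<^sub>R x2 t - (3 / t\<^sup>2) *\<^sub>R x1 t + G' (x1 t) = 0"
proof -
  have "((\<lambda>s. 3 / s) has_real_derivative - 3 / t\<^sup>2) (at t)"
    using t by (auto intro!: derivative_eq_intros simp: power2_eq_square)
  then have q: "((\<lambda>s. (3 / s) *\<^sub>R x1 s) has_vector_derivative
      ((3 / t) *\<^sub>R x2 t + (- 3 / t\<^sup>2) *\<^sub>R x1 t)) (at t)"
    using x1 by (rule has_vector_derivative_scaleR)
  interpret G': bounded_linear G' using G by (rule has_derivative_bounded_linear)
  have "((\<lambda>s. G (x s)) has_derivative (\<lambda>h. G' (h *\<^sub>R x1 t))) (at t)"
    using has_derivative_compose[OF x[unfolded has_vector_derivative_def] G] by simp
  then have "((\<lambda>s. G (x s)) has_vector_derivative G' (x1 t)) (at t)"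
    by (simp add: has_vector_derivative_def G'.scaleR)
  with x2 q have "((\<lambda>s. x2 s + (3 / s) *\<^sub>R x1 s + G (x s)) has_vector_derivative
      x3 t + ((3 / t) *\<^sub>R x2 t + (- 3 / t\<^sup>2) *\<^sub>R x1 t) + G' (x1 t)) (at t)"
    by (intro has_vector_derivative_add)
  then have "((\<lambda>_. 0) has_vector_derivative
      x3 t + ((3 / t) *\<^sub>R x2 t + (- 3 / t\<^sup>2) *\<^sub>R x1 t) + G' (x1 t)) (at t)"
    by (rule has_vector_derivative_transform_within_open[of _ _ _ "{0<..}"]) (use ode t in auto)
  from vector_derivative_unique_at[OF this has_vector_derivative_const]
  show ?thesis by (simp add: algebra_simps)
qed

text \<open>An exact identity whose summands can each be bounded by a multiple of
  \<open>h ^ 4\<close>: three Taylor remainders of order four, the linearization error of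
  \<open>G\<close> at an increment of size \<open>h\<close>, the error of replacing
  \<open>v h\<close> by \<open>h *\<^sub>R a1\<close>, and a leftover. The leftover stems from
  \<open>3 * h\<^sup>2 / t\<^sup>2\<close> times the quadratic and cubic terms of
  \<open>x (t - h)\<close>; the \<open>h ^ 4 / t\<close> multiples of \<open>a3\<close> from
  \<open>t + h\<close> and \<open>t - 2 * h\<close> cancel each other.\<close>

lemma sag_truncation_error_expansion:
  fixes G :: "'a::real_inner \<Rightarrow> 'a" and x :: "real \<Rightarrow> 'a"
  assumes A: "linear A"
    and ode: "a2 + (3 / t) *\<^sub>R a1 + G (x t) = 0"
    and ode': "a3 + (3 / t) *\<^sub>R a2 - (3 / t\<^sup>2) *\<^sub>R a1 + A a1 = 0"
  defines "R \<equiv> \<lambda>s. x s - (x t + (s - t) *\<^sub>R a1 + ((s - t)\<^sup>2 / 2) *\<^sub>R a2 + ((s - t) ^ 3 / 6) *\<^sub>R a3)"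
    and "v \<equiv> \<lambda>h. ((t - 3 * h) / t) *\<^sub>R (x t - x (t - h))"
  shows "sag_truncation_error G x t h =
    (2 + 4 * h / t) *\<^sub>R R (t + h) + (4 + 3 * h\<^sup>2 / t\<^sup>2) *\<^sub>R R (t - h) - (1 - h / (2 * t)) *\<^sub>R R (t - 2 * h)
    + h\<^sup>2 *\<^sub>R (G (x t + v h) - G (x t) - A (v h)) + h\<^sup>2 *\<^sub>R A (v h - h *\<^sub>R a1)
    + (h ^ 4 / (2 * t\<^sup>2)) *\<^sub>R (3 *\<^sub>R a2 - h *\<^sub>R a3)"
proof -
  have G: "G (x t) = - a2 - (3 / t) *\<^sub>R a1"
    using ode by (simp add: algebra_simps eq_neg_iff_add_eq_0)
  have Aa: "A a1 = - a3 - (3 / t) *\<^sub>R a2 + (3 / t\<^sup>2) *\<^sub>R a1"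
    using ode' by (simp add: algebra_simps eq_neg_iff_add_eq_0)
  have Av: "A (v h - h *\<^sub>R a1) = A (v h) - h *\<^sub>R A a1"
    by (simp add: linear_diff[OF A] linear_cmul[OF A])
  have x: "x s = R s + x t + (s - t) *\<^sub>R a1 + ((s - t)\<^sup>2 / 2) *\<^sub>R a2 + ((s - t) ^ 3 / 6) *\<^sub>R a3" for s
    by (simp add: R_def)
  define w where "w = x t"
  \<comment> \<open>Naming this value shields the \<open>x (t - h)\<close> inside the argument of
    \<open>G\<close> from the Taylor rewriting below.\<close>
  define g where "g = G (x t + v h)"
  have g: "G (x t + ((t - 3 * h) / t) *\<^sub>R (x t - x (t - h))) = g"
    by (simp add: g_def v_def)
  \<comment> \<open>With \<open>i\<close> in place of division by \<open>t\<close>, both sides are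
    polynomial.\<close>
  define i where "i = 1 / t"
  have i: "c / t = c * i" "c / t\<^sup>2 = c * i * i" "c / (2 * t) = c * i / 2" "c / (2 * t\<^sup>2) = c * i * i / 2" for c
    by (simp_all add: i_def power2_eq_square)
  \<comment> \<open>Pairing with an arbitrary \<open>z\<close> turns the vector identity into a
    scalar polynomial identity, which \<open>algebra\<close> decides.\<close>
  have "z \<bullet> sag_truncation_error G x t h = z \<bullet> (
    (2 + 4 * h / t) *\<^sub>R R (t + h) + (4 + 3 * h\<^sup>2 / t\<^sup>2) *\<^sub>R R (t - h) - (1 - h / (2 * t)) *\<^sub>R R (t - 2 * h)
    + h\<^sup>2 *\<^sub>R (G (x t + v h) - G (x t) - A (v h)) + h\<^sup>2 *\<^sub>R A (v h - h *\<^sub>R a1)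
    + (h ^ 4 / (2 * t\<^sup>2)) *\<^sub>R (3 *\<^sub>R a2 - h *\<^sub>R a3))" for z
    unfolding sag_truncation_error_eq g g_def[symmetric] Av G Aa
    unfolding x[of "t + h"] x[of "t - h"] x[of "t - 2 * h"] w_def[symmetric] i
      inner_add_right inner_diff_right inner_minus_right inner_scaleR_right
    by algebra
  then show ?thesis
    using vector_eq_ldot by blast
qed

section \<open>Estimating the expansion term by term\<close>

theorem theorem3:
  fixes F :: "real ^ 'd \<Rightarrow> real"
    and D1 :: "real ^ 'd \<Rightarrow> (real ^ 'd) \<Rightarrow>\<^sub>L (real ^ 'd)"
    and D2 :: "real ^ 'd \<Rightarrow> (real ^ 'd) \<Rightarrow>\<^sub>L ((real ^ 'd) \<Rightarrow>\<^sub>L (real ^ 'd))"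
    and x x1 x2 x3 x4 :: "real \<Rightarrow> real ^ 'd"
    and t :: real
  assumes F_differentiable: "\<And>y. F differentiable (at y)"
    and grad_deriv1: "\<And>y. (grad F has_derivative blinfun_apply (D1 y)) (at y)"
    and grad_deriv2: "\<And>y. (D1 has_derivative blinfun_apply (D2 y)) (at y)"
    and grad_deriv2_continuous: "continuous_on UNIV D2"
    and grad_deriv1_bounded: "bounded (range D1)"
    and grad_deriv2_bounded: "bounded (range D2)"
    and x_deriv1: "\<And>s. s \<ge> 0 \<Longrightarrow> (x has_vector_derivative x1 s) (at s within {0..})"
    and x_deriv2: "\<And>s. s \<ge> 0 \<Longrightarrow> (x1 has_vector_derivative x2 s) (at s within {0..})"
    and x_deriv3: "\<And>s. s \<ge> 0 \<Longrightarrow> (x2 has_vector_derivative x3 s) (at s within {0..})"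
    and x_deriv4: "\<And>s. s \<ge> 0 \<Longrightarrow> (x3 has_vector_derivative x4 s) (at s within {0..})"
    and x_deriv4_continuous: "continuous_on {0..} x4"
    and ode: "\<And>s. s > 0 \<Longrightarrow> x2 s + (3 / s) *\<^sub>R x1 s + grad F (x s) = 0"
    and t_pos: "t > 0"
  shows "(\<forall>h. sag_truncation_error (grad F) x t h =
             (2 + 4 * h / t) *\<^sub>R x (t + h)
             - (5 + 9 * h / (2 * t) + 3 * h\<^sup>2 / t\<^sup>2) *\<^sub>R x t
             + (4 + 3 * h\<^sup>2 / t\<^sup>2) *\<^sub>R x (t - h)
             - (1 - h / (2 * t)) *\<^sub>R x (t - 2 * h)
             + h\<^sup>2 *\<^sub>R grad F (x t + ((t - 3 * h) / t) *\<^sub>R (x t - x (t - h))))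
         \<and> (\<lambda>h. norm (sag_truncation_error (grad F) x t h)) \<in> O[at_right 0](\<lambda>h. h ^ 4)"
proof (intro conjI allI)
  show "sag_truncation_error (grad F) x t h =
             (2 + 4 * h / t) *\<^sub>R x (t + h)
             - (5 + 9 * h / (2 * t) + 3 * h\<^sup>2 / t\<^sup>2) *\<^sub>R x t
             + (4 + 3 * h\<^sup>2 / t\<^sup>2) *\<^sub>R x (t - h)
             - (1 - h / (2 * t)) *\<^sub>R x (t - 2 * h)
             + h\<^sup>2 *\<^sub>R grad F (x t + ((t - 3 * h) / t) *\<^sub>R (x t - x (t - h)))" for h
    by (rule sag_truncation_error_eq)
  \<comment> \<open>A compact interval on which continuous derivatives are bounded; it contains
    \<open>t + h\<close>, \<open>t - h\<close> and \<open>t - 2 * h\<close> whenever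
    \<open>0 < h < t / 2\<close>.\<close>
  define S where "S = {0..2 * t}"
  have S: "convex S" "t \<in> S" "S \<subseteq> {0..}"
    using t_pos by (auto simp: S_def)
  have derivs: "(x has_vector_derivative x1 s) (at s within S)"
    "(x1 has_vector_derivative x2 s) (at s within S)"
    "(x2 has_vector_derivative x3 s) (at s within S)"
    "(x3 has_vector_derivative x4 s) (at s within S)" if "s \<in> S" for s
    using that S(3) x_deriv1 x_deriv2 x_deriv3 x_deriv4
    by (meson atLeast_iff has_vector_derivative_within_subset subsetD)+
  have "continuous_on S x1" "continuous_on S x2" "continuous_on S x4"
    using derivs(2,3)[THEN has_vector_derivative_continuous]
      continuous_on_subset[OF x_deriv4_continuous S(3)]
    by (simp_all add: continuous_on_eq_continuous_within)
  then obtain M1 M2 M4 where M: "\<And>s. s \<in> S \<Longrightarrow> norm (x1 s) \<le> M1" "\<And>s. s \<in> S \<Longrightarrow> norm (x2 s) \<le> M2"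
      "\<And>s. s \<in> S \<Longrightarrow> norm (x4 s) \<le> M4"
    unfolding S_def by (metis continuous_on_Icc_norm_bound)
  obtain K where K: "\<And>y. norm (D2 y) \<le> K"
    using grad_deriv2_bounded by (auto simp: bounded_iff)
  define A where "A = D1 (x t)"
  define R where "R s = x s - (x t + (s - t) *\<^sub>R x1 t + ((s - t)\<^sup>2 / 2) *\<^sub>R x2 t + ((s - t) ^ 3 / 6) *\<^sub>R x3 t)" for s
  define v where "v h = ((t - 3 * h) / t) *\<^sub>R (x t - x (t - h))" for h
  have K_nonneg: "K \<ge> 0"
    using K[of 0] norm_ge_zero order_trans by blast
  define f where "f k = [x, x1, x2, x3, x4] ! k" for k
  have f: "f 0 = x" "f (Suc 0) = x1" "f 2 = x2" "f 3 = x3" "f 4 = x4"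
    by (simp_all add: f_def eval_nat_numeral)
  have f_deriv: "(f k has_vector_derivative f (Suc k) s) (at s within S)" if "k < 4" "s \<in> S" for k s
    using that derivs by (auto simp: f_def less_Suc_eq eval_nat_numeral)
  \<comment> \<open>Order 4 means summands with \<open>k < 4\<close>: the cubic polynomial in
    \<open>R\<close>, where 2 and 6 are \<open>fact 2\<close> and \<open>fact 3\<close>. The bound
    \<open>M4\<close> on \<open>x4\<close> controls the remainder.\<close>
  have R: "norm (R s) \<le> M4 * \<bar>s - t\<bar> ^ 4" if "s \<in> S" for s
    using vector_taylor_bound[OF S(1,2) that, of 4 f M4] f_deriv M(3)
    by (simp add: f R_def eval_nat_numeral) (simp add: numeral_2_eq_2[symmetric] numeral_3_eq_3[symmetric] f)
  have x_lin: "norm (x s - x t - (s - t) *\<^sub>R x1 t) \<le> M2 * \<bar>s - t\<bar>\<^sup>2" if "s \<in> S" for s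
    using vector_taylor_bound[OF S(1,2) that, of 2 f M2] f_deriv M(2)
    by (simp add: f numeral_2_eq_2 diff_diff_eq) (simp add: numeral_2_eq_2[symmetric] f)
  have x_lip: "norm (x s - x t) \<le> M1 * \<bar>s - t\<bar>" if "s \<in> S" for s
    using vector_taylor_bound[OF S(1,2) that, of 1 f M1] derivs(1) M(1) by (simp add: f)

  have ode': "x3 t + (3 / t) *\<^sub>R x2 t - (3 / t\<^sup>2) *\<^sub>R x1 t + A (x1 t) = 0"
  proof -
    have "at t within {0..} = at t"
      using t_pos by (intro at_within_interior) simp
    then show ?thesis
      using ode_derivative[where G = "grad F" and x = x and t = t and ?x1.0 = x1 and ?x2.0 = x2 and ?x3.0 = x3,
          OF grad_deriv1] x_deriv1[of t] x_deriv2[of t] x_deriv3[of t]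
        ode t_pos by (simp add: A_def)
  qed

  \<comment> \<open>\<open>P * h\<^sup>2\<close> will bound \<open>v h - h *\<^sub>R x1 t\<close>,
    and \<open>Q * h ^ 4\<close> the leftover term; the \<open>t / 2\<close> in \<open>Q\<close>
    comes from \<open>h < t / 2\<close>.\<close>
  define P where "P = M2 + 3 / t * M1"
  define Q where "Q = (3 * norm (x2 t) + t / 2 * norm (x3 t)) / (2 * t\<^sup>2)"
  \<comment> \<open>Since \<open>h / t \<le> 1 / 2\<close>, the coefficients of the three remainders
    are at most 4, 5 and 1 in absolute value; 16 is \<open>2 ^ 4\<close>, from the distance
    \<open>2 * h\<close>.\<close>
  define C where "C = 4 * M4 + 5 * M4 + 16 * M4 + K * M1\<^sup>2 + norm A * P + Q"
  have bound: "norm (sag_truncation_error (grad F) x t h) \<le> C * h ^ 4" if h: "0 < h" "h < t / 2" for h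
  proof -
    have mem: "t + h \<in> S" "t - h \<in> S" "t - 2 * h \<in> S"
      using h by (auto simp: S_def)
    have ht: "0 \<le> h / t" "h / t \<le> 1 / 2"
      using h t_pos by (simp_all add: field_simps)
    have "(h / t)\<^sup>2 \<le> (1 / 2)\<^sup>2"
      using ht by (intro power_mono)
    then have ht2: "h\<^sup>2 / t\<^sup>2 \<le> 1 / 4" "0 \<le> h\<^sup>2 / t\<^sup>2"
      by (simp_all add: power_divide)
    have "\<bar>2 + 4 * h / t\<bar> \<le> 4"
      using ht by simp
    then have 1: "norm ((2 + 4 * h / t) *\<^sub>R R (t + h)) \<le> 4 * (M4 * h ^ 4)"
      unfolding norm_scaleR using R[OF mem(1)] h by (intro mult_mono) auto
    have "\<bar>4 + 3 * h\<^sup>2 / t\<^sup>2\<bar> \<le> 5"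
      using ht2 by simp
    then have 2: "norm ((4 + 3 * h\<^sup>2 / t\<^sup>2) *\<^sub>R R (t - h)) \<le> 5 * (M4 * h ^ 4)"
      unfolding norm_scaleR using R[OF mem(2)] h by (intro mult_mono) auto
    have "\<bar>1 - h / (2 * t)\<bar> \<le> 1"
      using ht by simp
    then have 3: "norm ((1 - h / (2 * t)) *\<^sub>R R (t - 2 * h)) \<le> 1 * (M4 * (16 * h ^ 4))"
      unfolding norm_scaleR using R[OF mem(3)] h by (intro mult_mono) (auto simp: power_mult_distrib)
    have dx: "norm (x t - x (t - h)) \<le> M1 * h"
      using x_lip[OF mem(2)] h by (simp add: norm_minus_commute)
    \<comment> \<open>The quotient may be negative, but \<open>h < t / 2\<close> keeps it between
      \<open>- 1 / 2\<close> and 1.\<close>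
    have "\<bar>(t - 3 * h) / t\<bar> \<le> 1"
      using h t_pos by (simp add: abs_le_iff divide_simps)
    then have "norm (v h) \<le> 1 * (M1 * h)"
      unfolding v_def norm_scaleR using dx by (intro mult_mono) auto
    then have "(norm (v h))\<^sup>2 \<le> (M1 * h)\<^sup>2"
      by (intro power_mono) auto
    then have "norm (grad F (x t + v h) - grad F (x t) - A (v h)) \<le> K * (M1 * h)\<^sup>2"
      using taylor_bound_blinfun[OF grad_deriv1 grad_deriv2 K, of "x t" "v h"] K_nonneg
      unfolding A_def by (meson mult_left_mono order_trans)
    then have 4: "norm (h\<^sup>2 *\<^sub>R (grad F (x t + v h) - grad F (x t) - A (v h))) \<le> h\<^sup>2 * (K * (M1 * h)\<^sup>2)"
      by (simp add: mult_left_mono)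
    have x_lin': "norm (- (x (t - h) - x t - (t - h - t) *\<^sub>R x1 t)) \<le> M2 * h\<^sup>2"
      using x_lin[OF mem(2)] by (simp only: norm_minus_cancel) simp
    have "norm ((3 * h / t) *\<^sub>R (x t - x (t - h))) \<le> 3 * h / t * (M1 * h)"
      unfolding norm_scaleR using dx h t_pos by (intro mult_mono) auto
    note tail = x_lin' this
    \<comment> \<open>Writing the extrapolation factor as \<open>1 - 3 * h / t\<close> separates the
      negated first-order Taylor remainder at \<open>t - h\<close> from a product of two factors of
      order \<open>h\<close>; both parts are of order \<open>h\<^sup>2\<close>.\<close>
    have "v h - h *\<^sub>R x1 t = - (x (t - h) - x t - (t - h - t) *\<^sub>R x1 t) - (3 * h / t) *\<^sub>R (x t - x (t - h))"
      using t_pos by (simp add: v_def diff_divide_distrib algebra_simps)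
    also have "norm \<dots> \<le> M2 * h\<^sup>2 + 3 * h / t * (M1 * h)"
      by (intro norm_triangle_le_diff add_mono tail)
    also have "\<dots> = P * h\<^sup>2"
      by (simp add: P_def algebra_simps power2_eq_square)
    finally have "norm (A (v h - h *\<^sub>R x1 t)) \<le> norm A * (P * h\<^sup>2)"
      using norm_blinfun[of A "v h - h *\<^sub>R x1 t"] norm_ge_zero[of A] by (meson mult_left_mono order_trans)
    then have 5: "norm (h\<^sup>2 *\<^sub>R A (v h - h *\<^sub>R x1 t)) \<le> h\<^sup>2 * (norm A * (P * h\<^sup>2))"
      by (simp add: mult_left_mono)
    have "norm (3 *\<^sub>R x2 t - h *\<^sub>R x3 t) \<le> 3 * norm (x2 t) + t / 2 * norm (x3 t)"
      using h mult_right_mono[of h "t / 2" "norm (x3 t)"] by (intro norm_triangle_le_diff add_mono) auto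
    then have "h ^ 4 / (2 * t\<^sup>2) * norm (3 *\<^sub>R x2 t - h *\<^sub>R x3 t)
        \<le> h ^ 4 / (2 * t\<^sup>2) * (3 * norm (x2 t) + t / 2 * norm (x3 t))"
      by (intro mult_left_mono) auto
    then have 6: "norm ((h ^ 4 / (2 * t\<^sup>2)) *\<^sub>R (3 *\<^sub>R x2 t - h *\<^sub>R x3 t)) \<le> Q * h ^ 4"
      by (simp add: Q_def mult.commute)
    have expansion: "sag_truncation_error (grad F) x t h =
      (2 + 4 * h / t) *\<^sub>R R (t + h) + (4 + 3 * h\<^sup>2 / t\<^sup>2) *\<^sub>R R (t - h) - (1 - h / (2 * t)) *\<^sub>R R (t - 2 * h)
      + h\<^sup>2 *\<^sub>R (grad F (x t + v h) - grad F (x t) - A (v h)) + h\<^sup>2 *\<^sub>R A (v h - h *\<^sub>R x1 t)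
      + (h ^ 4 / (2 * t\<^sup>2)) *\<^sub>R (3 *\<^sub>R x2 t - h *\<^sub>R x3 t)"
      unfolding R_def v_def
      by (rule sag_truncation_error_expansion[where G = "grad F" and x = x and t = t and A = "blinfun_apply A",
            OF _ ode[OF t_pos] ode'])
        (intro bounded_linear.linear blinfun.bounded_linear_right)
    have "norm (sag_truncation_error (grad F) x t h)
      \<le> 4 * (M4 * h ^ 4) + 5 * (M4 * h ^ 4) + 1 * (M4 * (16 * h ^ 4))
        + h\<^sup>2 * (K * (M1 * h)\<^sup>2) + h\<^sup>2 * (norm A * (P * h\<^sup>2))
        + Q * h ^ 4"
      unfolding expansion
      by (intro norm_triangle_le norm_triangle_le_diff add_mono 1 2 3 4 5 6)
    also have "\<dots> = C * h ^ 4"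
      unfolding C_def by algebra
    finally show ?thesis .
  qed
  have "eventually (\<lambda>h. 0 < h \<and> h < t / 2) (at_right 0)"
    using t_pos by (auto simp: eventually_at_right_field intro!: exI[of _ "t / 2"])
  then show "(\<lambda>h. norm (sag_truncation_error (grad F) x t h)) \<in> O[at_right 0](\<lambda>h. h ^ 4)"
    by (intro bigoI[of _ C]) (auto elim!: eventually_mono dest: bound)
qed

end
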